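(* Let $V$ be a superspace of dimension $n|m$ and let $T\in\Lambda^2(V)$ be an even bivector with components $T^{ab}$, regarded as the function $T(p)=T^{cd}p^1_cp^2_d$ of two even covectors $p^1,p^2$. Then the Khudaverdian relations for $T$, $$\frac{\partial T}{\partial p_a^i}\frac{\partial T}{\partial p_b^j}-\frac{\partial T}{\partial p_a^j}\frac{\partial T}{\partial p_b^i}-T\,\frac{\partial^2T}{\partial p_a^i\,\partial p_b^j}=0\qquad\text{for all } i,j\in\{1,2\}\text{ and all indices }a,b,$$ are equivalent to the super Plücker relations $$T^{ab}T^{cd}(-1)^{\tilde b(\tilde a+\tilde c+\tilde d)}=T^{ac}T^{bd}(-1)^{\tilde c(\tilde a+\tilde d)}+T^{ad}T^{cb}(-1)^{\tilde b\tilde c+\tilde a\tilde d}\qquad\text{for all indices } a,b,c,d.$$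
   Context: Indices $a,b,c,d$ run over $\{1,\dots,n\}\cup\{\hat1,\dots,\hat m\}$, with parity $\tilde a=0$ for $a\in\{1,\dots,n\}$ and $\tilde a=1$ for $a\in\{\hat1,\dots,\hat m\}$. An even bivector is $T=T^{ab}e_a\wedge e_b$ (sum over all indices) where $e_a$ is a homogeneous basis of $V$, $T^{ab}$ are elements of a commutative superalgebra over $\mathbb R$, of parity $\tilde a+\tilde b$, and $T^{ab}=-(-1)^{\tilde a\tilde b}T^{ba}$. The components $p^1_a,p^2_a$ of the two even covectors are independent variables of parity $\tilde a$ (supercommuting with each other and with the $T^{ab}$); derivatives are left derivatives and the Khudaverdian relations are identities in these variables. These are the relations for degree $2|0$ of the general Khudaverdian relations for an even multivector $F\in\Lambda^{r|s}(V)$, $$\frac{\partial F}{\partial p_a^i}\frac{\partial F}{\partial p_b^j}-(-1)^{\tilde\imath\tilde\jmath+\tilde a(\tilde\imath+\tilde\jmath)}\frac{\partial F}{\partial p_a^j}\frac{\partial F}{\partial p_b^i}-F\frac{\partial^2F}{\partial p_a^i\partial p_b^j}=0,$$ where $i,j$ label $r$ even and $s$ odd covector arguments. *)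

theory Defs
  imports Complex_Main "HOL-Library.Multiset" "HOL-Library.Countable"
begin

section \<open>Commutative superalgebras\<close>

text \<open>Parities are natural numbers read modulo 2, so that signs can be written as powers of
  \<open>-1\<close>; \<open>homog k\<close> is the subspace of elements of parity \<open>k mod 2\<close>.\<close>

class comm_superalgebra = real_algebra_1 +
  fixes homog :: "nat \<Rightarrow> 'a set"
  assumes homog_periodic: "homog (k + 2) = homog k"
    and homog_add: "x \<in> homog k \<Longrightarrow> y \<in> homog k \<Longrightarrow> x + y \<in> homog k"
    and homog_scaleR: "x \<in> homog k \<Longrightarrow> r *\<^sub>R x \<in> homog k"
    and homog_split: "\<exists>y\<in>homog 0. \<exists>z\<in>homog 1. x = y + z"
    and homog_disjoint: "homog 0 \<inter> homog 1 = {0}"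
    and homog_one: "1 \<in> homog 0"
    and homog_mult: "x \<in> homog i \<Longrightarrow> y \<in> homog j \<Longrightarrow> x * y \<in> homog (i + j)"
    and supercommute: "x \<in> homog i \<Longrightarrow> y \<in> homog j \<Longrightarrow> x * y = (- 1) ^ (i * j) * (y * x)"

text \<open>The real numbers are a purely even example; algebras with odd elements arise from it by the
  polynomial construction below.\<close>

instantiation real :: comm_superalgebra
begin

definition homog_real :: "nat \<Rightarrow> real set" where
  "homog_real k = (if even k then UNIV else {0})"

instance
proof
  fix x y :: real and i j :: nat
  show "x \<in> homog i \<Longrightarrow> y \<in> homog j \<Longrightarrow> x * y = (- 1) ^ (i * j) * (y * x)"
    by (cases "even i") (auto simp: homog_real_def mult.commute)
qed (auto simp: homog_real_def split: if_splits)

end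

definition even_part :: "'a::comm_superalgebra \<Rightarrow> 'a" where
  "even_part x = (THE y. y \<in> homog 0 \<and> x - y \<in> homog 1)"

text \<open>\<open>twist k x\<close> is what becomes of \<open>x\<close> when something of parity \<open>k\<close> is moved past it:
  \<open>(-1) ^ (k * j) * x\<close> for \<open>x\<close> of parity \<open>j\<close>, extended additively.\<close>

definition twist :: "nat \<Rightarrow> 'a::comm_superalgebra \<Rightarrow> 'a" where
  "twist k x = (if even k then x else even_part x - (x - even_part x))"

lemma homog_even: "even k \<Longrightarrow> homog k = homog 0"
  and homog_odd: "odd k \<Longrightarrow> homog k = homog 1"
proof -
  have *: "homog (2 * l + j) = homog j" for l j
    by (induction l) (use homog_periodic in \<open>auto simp: algebra_simps\<close>)
  show "even k \<Longrightarrow> homog k = homog 0" by (metis * add_0_right evenE)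
  show "odd k \<Longrightarrow> homog k = homog 1" by (metis * oddE)
qed

lemma homog_cong: "even i = even j \<Longrightarrow> homog i = homog j"
  by (metis homog_even homog_odd)

lemma homog_0 [simp]: "0 \<in> homog k"
  using homog_disjoint homog_even[of k] homog_odd[of k] by blast

lemma homog_minus: "x \<in> homog k \<Longrightarrow> - x \<in> homog k"
  using homog_scaleR[of x k "-1"] by simp

lemma homog_diff: "x \<in> homog k \<Longrightarrow> y \<in> homog k \<Longrightarrow> x - y \<in> homog k"
  using homog_add[of x k "- y"] homog_minus[of y k] by simp

definition sg :: "nat \<Rightarrow> 'a::ring_1 \<Rightarrow> 'a" where
  "sg k x = (- 1) ^ k * x"

lemma sg_simps [simp]:
  "x * sg k y = sg k (x * y)" "sg k x * y = sg k (x * y)" "sg k (sg l x) = sg (k + l) x"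
  "sg 0 x = x" "sg k 0 = 0"
  by (cases "even k"; simp add: sg_def power_add mult.assoc)+

lemma sg_cong: "even k = even l \<Longrightarrow> sg k x = sg l x"
  by (cases "even k") (auto simp: sg_def)

lemma sg_add: "sg k (x + y) = sg k x + sg k y"
  by (simp add: sg_def distrib_left)

lemma sg_scaleR: "sg k (r *\<^sub>R x) = r *\<^sub>R sg k (x :: 'a::real_algebra_1)"
  by (simp add: sg_def)

lemma sg_sum: "sg k (sum f I) = (\<Sum>i\<in>I. sg k (f i))"
  by (simp add: sg_def sum_distrib_left)

lemma homog_sgn: "x \<in> homog k \<Longrightarrow> (- 1) ^ l * x \<in> homog k"
  by (cases "even l") (simp_all add: homog_minus)

lemma homog_sg: "x \<in> homog k \<Longrightarrow> sg l x \<in> homog k"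
  by (simp add: sg_def homog_sgn)

lemma homog_sum: "(\<And>i. i \<in> I \<Longrightarrow> f i \<in> homog k) \<Longrightarrow> sum f I \<in> homog k"
  by (induction I rule: infinite_finite_induct) (auto intro: homog_add)

lemma even_part_eqI:
  assumes "y \<in> homog 0" "z \<in> homog 1" shows "even_part (y + z) = y"
  unfolding even_part_def
proof (rule the_equality)
  show "y \<in> homog 0 \<and> y + z - y \<in> homog 1" using assms by simp
  fix w assume w: "w \<in> homog 0 \<and> y + z - w \<in> homog 1"
  have "(y + z - w) - z \<in> homog 1" using w assms(2) homog_diff by blast
  moreover have "y - w \<in> homog 0" using w assms(1) homog_diff by blast
  ultimately have "y - w \<in> homog 0 \<inter> homog 1" by (simp add: algebra_simps)
  then show "w = y" using homog_disjoint by (metis eq_iff_diff_eq_0 singletonD)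
qed

lemma homog_split_at: "\<exists>y. y \<in> homog k \<and> (x :: 'a::comm_superalgebra) - y \<in> homog (Suc k)"
proof -
  obtain a b :: 'a where *: "x = a + b" "a \<in> homog 0" "b \<in> homog 1" by (metis homog_split)
  then have **: "x - a = b" "x - b = a" by simp_all
  show ?thesis
  proof (cases "even k")
    case True
    then have "homog k = (homog 0 :: 'a set)" "homog (Suc k) = (homog 1 :: 'a set)"
      by (simp_all add: homog_cong[of k 0] homog_cong[of "Suc k" 1])
    then show ?thesis using * ** by metis
  next
    case False
    then have "homog k = (homog 1 :: 'a set)" "homog (Suc k) = (homog 0 :: 'a set)"
      by (simp_all add: homog_cong[of k 1] homog_cong[of "Suc k" 0])
    then show ?thesis using * ** by metis
  qed
qed

lemma homog_disjoint_at: "x \<in> homog k \<Longrightarrow> x \<in> homog (Suc k) \<Longrightarrow> x = 0"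
  using homog_disjoint homog_cong[of k 0] homog_cong[of "Suc k" 0] homog_cong[of k 1] homog_cong[of "Suc k" 1]
  by (cases "even k") auto

lemma twist_split:
  assumes "y \<in> homog 0" "z \<in> homog 1" shows "twist k (y + z) = y + (- 1) ^ k * z"
  using even_part_eqI[OF assms] by (auto simp: twist_def)

lemma twist_homog: "x \<in> homog j \<Longrightarrow> twist k x = (- 1) ^ (k * j) * x"
  using twist_split[of x 0 k] twist_split[of 0 x k] homog_even[of j] homog_odd[of j]
  by (cases "even j"; cases "even k") auto

lemma twist_sg: "x \<in> homog j \<Longrightarrow> twist k x = sg (k * j) x"
  by (simp add: sg_def twist_homog)

lemma twist_add [simp]: "twist k (x + y) = twist k x + twist k y"
proof -
  obtain a b c d where *: "x = a + b" "y = c + d" "a \<in> homog 0" "b \<in> homog 1"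
      "c \<in> homog 0" "d \<in> homog 1"
    by (metis homog_split)
  have "x + y = (a + c) + (b + d)" by (simp add: * algebra_simps)
  then show ?thesis
    using * twist_split[OF homog_add[OF *(3,5)] homog_add[OF *(4,6)], of k]
    by (simp only: twist_split) (simp add: algebra_simps)
qed

lemma homog_induct [case_names homog add]:
  assumes "\<And>x k. x \<in> homog k \<Longrightarrow> P x" "\<And>x y. P x \<Longrightarrow> P y \<Longrightarrow> P (x + y)"
  shows "P x"
  by (metis assms homog_split)

lemma twist_0 [simp]: "twist k 0 = 0"
  using twist_homog[of 0 0 k] by simp

lemma twist_minus [simp]: "twist k (- x) = - twist k x"
  using twist_add[of k x "- x"] by (simp add: eq_neg_iff_add_eq_0 add.commute)

lemma twist_sgn [simp]: "twist k ((- 1) ^ l * x) = (- 1) ^ l * twist k x"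
  by (cases "even l") auto

lemma twist_of_sg [simp]: "twist k (sg l x) = sg l (twist k x)"
  by (simp add: sg_def)

lemma twist_sum: "twist k (sum f I) = (\<Sum>i\<in>I. twist k (f i))"
  by (induction I rule: infinite_finite_induct) auto

lemma twist_of_nat: "twist k (of_nat c * x) = of_nat c * twist k x"
  by (induction c) (auto simp: algebra_simps)

lemma twist_1 [simp]: "twist k 1 = 1"
  using twist_homog[OF homog_one, of k] by simp

lemma twist_in_homog: "x \<in> homog j \<Longrightarrow> twist k x \<in> homog j"
  by (simp add: twist_homog homog_sgn)

lemma twist_scaleR: "twist k (r *\<^sub>R x) = r *\<^sub>R twist k x"
proof (induction x rule: homog_induct)
  case (homog x j) then show ?case by (simp add: twist_homog[of _ j] homog_scaleR)
qed (simp add: scaleR_add_right)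

lemma twist_twist: "twist k (twist l x) = twist (k + l) x"
proof (induction x rule: homog_induct)
  case (homog x j)
  then show ?case by (simp add: twist_homog[of _ j] homog_sgn distrib_right)
      (cases "even (k * j)"; cases "even (l * j)"; simp add: power_add)
qed simp

lemma twist_mult: "twist k (x * y) = twist k x * twist k y"
proof (induction x rule: homog_induct)
  case (homog x i)
  show ?case
  proof (induction y rule: homog_induct)
    case (homog y j)
    with \<open>x \<in> homog i\<close> show ?case
      by (simp add: twist_homog[of _ i] twist_homog[of _ j] twist_homog[of _ "i + j"] homog_mult)
        (cases "even (k * i)"; cases "even (k * j)"; simp add: distrib_left power_add)
  qed (simp add: distrib_left)
qed (simp add: distrib_right)

section \<open>Polynomials in supercommuting variables\<close>

text \<open>\<open>Ev k\<close> is the even index \<open>k\<close>, \<open>Od k\<close> the odd index \<open>k\<close> (written with a hat).\<close>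

datatype index = Ev nat | Od nat

fun par :: "index \<Rightarrow> nat" where
  "par (Ev _) = 0"
| "par (Od _) = 1"

definition indices :: "nat \<Rightarrow> nat \<Rightarrow> index set" where
  "indices n m = Ev ` {1..n} \<union> Od ` {1..m}"

text \<open>\<open>P i a\<close> is the variable \<open>p\<^sup>i\<^sub>a\<close>, the \<open>a\<close>-th component of the \<open>i\<close>-th even covector.
  The polynomial algebra below has all these variables as generators; for two covectors on a
  superspace of dimension \<open>n|m\<close> only those with \<open>i = 1, 2\<close> and \<open>a \<in> indices n m\<close> occur.\<close>

datatype pvar = P nat index

fun vpar :: "pvar \<Rightarrow> nat" where
  "vpar (P i a) = par a"

instance index :: countable by countable_datatype
instance pvar :: countable by countable_datatype

text \<open>A multiset of variables stands for the product of its elements in increasing order, where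
  the variables are ordered by an arbitrary fixed enumeration. Since odd variables square to
  zero, a monomial contains each of them at most once. Bringing the product of the monomials
  \<open>M\<close> and \<open>N\<close> into increasing order gives the sign \<open>(-1) ^ crossings M N\<close>.\<close>

definition monomial :: "pvar multiset \<Rightarrow> bool" where
  "monomial M \<longleftrightarrow> (\<forall>v. odd (vpar v) \<longrightarrow> count M v \<le> 1)"

definition mpar :: "pvar multiset \<Rightarrow> nat" where
  "mpar M = (\<Sum>v\<in>#M. vpar v)"

definition crossings :: "pvar multiset \<Rightarrow> pvar multiset \<Rightarrow> nat" where
  "crossings M N = (\<Sum>u\<in>#M. \<Sum>v\<in>#N. if to_nat v < to_nat u then vpar u * vpar v else 0)"

lemma mpar_simps [simp]: "mpar {#} = 0" "mpar (add_mset v M) = vpar v + mpar M"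
    "mpar (M + N) = mpar M + mpar N"
  by (simp_all add: mpar_def)

lemma crossings_simps [simp]: "crossings {#} N = 0" "crossings M {#} = 0"
    "crossings (M + M') N = crossings M N + crossings M' N" "crossings M (N + N') = crossings M N + crossings M N'"
  by (simp_all add: crossings_def sum_mset.distrib)

lemma crossings_add_mset: "crossings (add_mset v M) N = crossings {#v#} N + crossings M N"
    "crossings N (add_mset v M) = crossings N {#v#} + crossings N M"
  using crossings_simps(3)[of "{#v#}" M N] crossings_simps(4)[of N "{#v#}" M] by simp_all

lemma crossings_self [simp]: "crossings {#v#} {#v#} = 0"
  by (simp add: crossings_def)

lemma monomial_empty [simp]: "monomial {#}"
  by (simp add: monomial_def)

lemma monomial_single [simp]: "monomial {#v#}"
  by (simp add: monomial_def)

lemma monomial_addD: assumes "monomial (M + N)" shows "monomial M" "monomial N"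
  using assms unfolding monomial_def by (metis add_leD1 add_leD2 count_union)+

lemma monomial_add_mset:
  "monomial (add_mset v M) \<longleftrightarrow> monomial M \<and> (odd (vpar v) \<longrightarrow> v \<notin># M)"
proof -
  have "monomial (add_mset v M) \<longleftrightarrow>
      (\<forall>w. odd (vpar w) \<longrightarrow> count M w + (if w = v then 1 else 0) \<le> 1)"
    by (auto simp: monomial_def)
  also have "\<dots> \<longleftrightarrow> (\<forall>w. odd (vpar w) \<longrightarrow> count M w \<le> 1 \<and> (w = v \<longrightarrow> count M v = 0))"
    by (intro all_cong1) auto
  finally show ?thesis by (auto simp: monomial_def not_in_iff)
qed

lemma vpar_cases: "vpar v = 0 \<or> vpar v = 1"
  by (cases v) (metis index.exhaust par.simps vpar.simps)

lemma crossings_commute_single: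
  "v \<notin># M \<or> even (vpar v) \<Longrightarrow> crossings {#v#} M + crossings M {#v#} = vpar v * mpar M"
proof (induction M)
  case (add u M)
  have "to_nat u \<noteq> to_nat v" if "odd (vpar v)"
    using that add.prems by auto
  then have *: "crossings {#v#} {#u#} + crossings {#u#} {#v#} = vpar v * vpar u"
    using vpar_cases[of v] by (cases "to_nat u" "to_nat v" rule: linorder_cases) (auto simp: crossings_def)
  show ?case
    using * add.IH add.prems crossings_add_mset(1)[of u M] crossings_add_mset(2)[of _ u M]
    by (auto simp: distrib_left)
qed simp

lemma crossings_commute:
  "monomial (M + N) \<Longrightarrow> crossings M N + crossings N M = mpar M * mpar N"
proof (induction M)
  case (add v M)
  then have "monomial (M + N)" "v \<notin># N \<or> even (vpar v)"
    by (auto simp: monomial_add_mset)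
  then show ?case
    using add.IH crossings_commute_single[of v N]
    by (simp add: crossings_add_mset(1)[of v M] crossings_add_mset(2)[of _ v M] distrib_right)
qed simp

definition splits :: "pvar multiset \<Rightarrow> (pvar multiset \<times> pvar multiset) set" where
  "splits K = {(M, N). M + N = K}"

lemma finite_splits [simp]: "finite (splits K)"
proof (induction K)
  case empty
  have "splits {#} = {({#}, {#})}" by (auto simp: splits_def)
  then show ?case by simp
next
  case (add v K)
  have "splits (add_mset v K) \<subseteq>
      (\<lambda>(M, N). (add_mset v M, N)) ` splits K \<union> (\<lambda>(M, N). (M, add_mset v N)) ` splits K"
  proof clarify
    fix M N assume *: "(M, N) \<in> splits (add_mset v K)"
      and n: "(M, N) \<notin> (\<lambda>(M, N). (M, add_mset v N)) ` splits K"
    from * have eq: "M + N = add_mset v K" by (simp add: splits_def)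
    then have "v \<in># M + N" by simp
    then consider "v \<in># M" | "v \<in># N" by auto
    then show "(M, N) \<in> (\<lambda>(M, N). (add_mset v M, N)) ` splits K"
    proof cases
      case 1
      then obtain M' where M': "M = add_mset v M'" by (metis multi_member_split)
      with eq have "(M', N) \<in> splits K" by (simp add: splits_def)
      with M' show ?thesis by (simp add: rev_image_eqI)
    next
      case 2
      then obtain N' where N': "N = add_mset v N'" by (metis multi_member_split)
      with eq have "(M, N') \<in> splits K" by (simp add: splits_def)
      with N' have "(M, N) \<in> (\<lambda>(M, N). (M, add_mset v N)) ` splits K"
        by (simp add: rev_image_eqI)
      with n show ?thesis by blast
    qed
  qed
  then show ?case by (rule finite_subset) (use add in simp)
qed

lemma splits_empty [simp]: "splits {#} = {({#}, {#})}"
  by (auto simp: splits_def)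

typedef (overloaded) 'a spoly =
  "{f :: pvar multiset \<Rightarrow> 'a::zero. finite {M. f M \<noteq> 0} \<and> (\<forall>M. \<not> monomial M \<longrightarrow> f M = 0)}"
  morphisms coeff Abs_spoly
  by (rule exI[of _ "\<lambda>_. 0"]) simp

setup_lifting type_definition_spoly

lemma finite_support [simp]: "finite {M. coeff f M \<noteq> 0}"
  and coeff_not_monomial: "\<not> monomial M \<Longrightarrow> coeff f M = 0"
  using coeff[of f] by auto

lemma spoly_eqI: "(\<And>M. monomial M \<Longrightarrow> coeff f M = coeff g M) \<Longrightarrow> f = g"
  by (metis coeff_inject coeff_not_monomial ext)

lemma finite_support_combine:
  assumes "finite {M. f M \<noteq> 0}" "finite {M. g M \<noteq> 0}" "\<And>M. f M = 0 \<Longrightarrow> g M = 0 \<Longrightarrow> h M = 0"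
  shows "finite {M. h M \<noteq> 0}"
proof (rule finite_subset)
  show "{M. h M \<noteq> 0} \<subseteq> {M. f M \<noteq> 0} \<union> {M. g M \<noteq> 0}"
    using assms(3) by auto
qed (use assms in simp)

lemma finite_support_times:
  fixes f g :: "pvar multiset \<Rightarrow> 'a::comm_superalgebra"
  assumes "finite {M. f M \<noteq> 0}" "finite {M. g M \<noteq> 0}"
  shows "finite {K. (if monomial K
    then \<Sum>(M, N)\<in>splits K. c M N * (f M * twist (mpar M) (g N)) else 0) \<noteq> 0}"
    (is "finite ?S")
proof (rule finite_subset)
  show "?S \<subseteq> (\<lambda>(M, N). M + N) ` ({M. f M \<noteq> 0} \<times> {M. g M \<noteq> 0})"
  proof
    fix K assume "K \<in> ?S"
    then have "(\<Sum>(M, N)\<in>splits K. c M N * (f M * twist (mpar M) (g N))) \<noteq> 0"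
      by (auto split: if_splits)
    then obtain M N where "(M, N) \<in> splits K" "c M N * (f M * twist (mpar M) (g N)) \<noteq> 0"
      by (metis (no_types, lifting) case_prodE sum.neutral case_prod_beta' prod.collapse)
    then have "M + N = K" "f M \<noteq> 0" "g N \<noteq> 0" by (auto simp: splits_def)
    then show "K \<in> (\<lambda>(M, N). M + N) ` ({M. f M \<noteq> 0} \<times> {M. g M \<noteq> 0})"
      by (intro rev_image_eqI[of "(M, N)"]) simp_all
  qed
qed (use assms in simp)

text \<open>Coefficients stand to the left of the variables, whence the twist in the product.\<close>

instantiation spoly :: (comm_superalgebra) "{zero, one, plus, minus, uminus, times, scaleR}"
begin

lift_definition zero_spoly :: "'a spoly" is "\<lambda>_. 0" by simp
lift_definition one_spoly :: "'a spoly" is "\<lambda>M. if M = {#} then 1 else 0" by auto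
lift_definition plus_spoly :: "'a spoly \<Rightarrow> 'a spoly \<Rightarrow> 'a spoly" is "\<lambda>f g M. f M + g M"
  subgoal for f g using finite_support_combine[of f g "\<lambda>M. f M + g M"] by simp
  done
lift_definition minus_spoly :: "'a spoly \<Rightarrow> 'a spoly \<Rightarrow> 'a spoly" is "\<lambda>f g M. f M - g M"
  subgoal for f g using finite_support_combine[of f g "\<lambda>M. f M - g M"] by simp
  done
lift_definition uminus_spoly :: "'a spoly \<Rightarrow> 'a spoly" is "\<lambda>f M. - f M"
  by simp
lift_definition scaleR_spoly :: "real \<Rightarrow> 'a spoly \<Rightarrow> 'a spoly" is "\<lambda>r f M. r *\<^sub>R f M"
  subgoal for r f using finite_support_combine[of f f "\<lambda>M. r *\<^sub>R f M"] by simp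
  done
lift_definition times_spoly :: "'a spoly \<Rightarrow> 'a spoly \<Rightarrow> 'a spoly" is
  "\<lambda>f g K. if monomial K
     then \<Sum>(M, N)\<in>splits K. (- 1) ^ crossings M N * (f M * twist (mpar M) (g N)) else 0"
  subgoal for f g
    using finite_support_times[of f g "\<lambda>M N. (- 1) ^ crossings M N"] by simp
  done
instance ..
end

lemma coeff_simps [simp]:
  "coeff 0 M = 0" "coeff 1 M = (if M = {#} then 1 else 0)"
  "coeff (f + g) M = coeff f M + coeff g M" "coeff (f - g) M = coeff f M - coeff g M"
  "coeff (- f) M = - coeff f M" "coeff (r *\<^sub>R f) M = r *\<^sub>R coeff f M"
  by (transfer, simp)+

lemma coeff_times:
  "monomial K \<Longrightarrow> coeff (f * g) K =
    (\<Sum>(M, N)\<in>splits K. sg (crossings M N) (coeff f M * twist (mpar M) (coeff g N)))"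
  unfolding sg_def by transfer simp

lemma splits_monomial: "monomial K \<Longrightarrow> (M, N) \<in> splits K \<Longrightarrow> monomial M \<and> monomial N"
  using monomial_addD[of M N] by (auto simp: splits_def)

lemma spoly_mult_assoc:
  fixes f g h :: "'a::comm_superalgebra spoly"
  shows "f * g * h = f * (g * h)"
proof (rule spoly_eqI)
  fix K :: "pvar multiset" assume K: "monomial K"
  define t where "t M M' N = sg (crossings M M' + crossings M N + crossings M' N)
    (coeff f M * (twist (mpar M) (coeff g M') * twist (mpar M + mpar M') (coeff h N)))" for M M' N
  have "coeff (f * g * h) K = (\<Sum>(L, N)\<in>splits K. \<Sum>(M, M')\<in>splits L. t M M' N)"
    unfolding coeff_times[OF K]
  proof (intro sum.cong refl, clarify)
    fix L N assume "(L, N) \<in> splits K"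
    then have L: "monomial L" using K splits_monomial by blast
    show "sg (crossings L N) (coeff (f * g) L * twist (mpar L) (coeff h N)) =
        (\<Sum>(M, M')\<in>splits L. t M M' N)"
      unfolding coeff_times[OF L] sum_distrib_left sum_distrib_right sg_sum t_def
      by (intro sum.cong refl) (auto simp: splits_def mult.assoc add_ac)
  qed
  also have "\<dots> = (\<Sum>((L, N), (M, M'))\<in>Sigma (splits K) (\<lambda>(L, N). splits L). t M M' N)"
    by (subst sum.Sigma[symmetric]) (auto simp: case_prod_beta)
  also have "\<dots> = (\<Sum>((M, L), (M', N))\<in>Sigma (splits K) (\<lambda>(M, L). splits L). t M M' N)"
    by (rule sum.reindex_bij_witness
          [of _ "\<lambda>((M, L), (M', N)). ((M + M', N), (M, M'))" "\<lambda>((L, N), (M, M')). ((M, M' + N), (M', N))"])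
      (auto simp: splits_def add.assoc)
  also have "\<dots> = (\<Sum>(M, L)\<in>splits K. \<Sum>(M', N)\<in>splits L. t M M' N)"
    by (subst sum.Sigma[symmetric]) (auto simp: case_prod_beta)
  also have "\<dots> = coeff (f * (g * h)) K"
    unfolding coeff_times[OF K]
  proof (intro sum.cong refl, clarify)
    fix M L assume "(M, L) \<in> splits K"
    then have L: "monomial L" using K splits_monomial by blast
    show "(\<Sum>(M', N)\<in>splits L. t M M' N) =
        sg (crossings M L) (coeff f M * twist (mpar M) (coeff (g * h) L))"
      unfolding coeff_times[OF L] twist_sum sum_distrib_left sg_sum t_def
      by (intro sum.cong refl) (auto simp: splits_def twist_mult twist_twist add_ac)
  qed
  finally show "coeff (f * g * h) K = coeff (f * (g * h)) K" .
qed

lemma sum_splits_single: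
  assumes "\<And>M N. (M, N) \<in> splits K \<Longrightarrow> (M, N) \<noteq> (A, B) \<Longrightarrow> F M N = 0" "A + B = K"
  shows "(\<Sum>(M, N)\<in>splits K. F M N) = (F A B :: 'a::comm_monoid_add)"
proof -
  have "(\<Sum>(M, N)\<in>splits K. F M N) = (\<Sum>(M, N)\<in>{(A, B)}. F M N)"
    by (intro sum.mono_neutral_right finite_splits) (use assms in \<open>auto simp: splits_def\<close>)
  then show ?thesis by simp
qed

instance spoly :: (comm_superalgebra) real_algebra_1
proof
  fix f g h :: "'a spoly" and r s :: real
  show "f * g * h = f * (g * h)" by (rule spoly_mult_assoc)
  show "(f + g) * h = f * h + g * h" "f * (g + h) = f * g + f * h"
      "r *\<^sub>R f * g = r *\<^sub>R (f * g)" "f * r *\<^sub>R g = r *\<^sub>R (f * g)"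
    by (rule spoly_eqI; simp add: coeff_times case_prod_beta algebra_simps sum.distrib[symmetric]
      scaleR_sum_right twist_scaleR sg_add sg_scaleR)+
  show "1 * f = f"
  proof (rule spoly_eqI)
    fix K :: "pvar multiset" assume "monomial K"
    then show "coeff (1 * f) K = coeff f K"
      by (subst coeff_times, simp, subst sum_splits_single[of _ "{#}" K]) (auto simp: twist_def splits_def)
  qed
  show "f * 1 = f"
  proof (rule spoly_eqI)
    fix K :: "pvar multiset" assume "monomial K"
    then show "coeff (f * 1) K = coeff f K"
      by (subst coeff_times, simp, subst sum_splits_single[of _ K "{#}"]) (auto simp: splits_def)
  qed
  have "coeff (0 :: 'a spoly) {#} \<noteq> coeff 1 {#}" by simp
  then show "(0 :: 'a spoly) \<noteq> 1" by metis
qed (rule spoly_eqI; simp add: algebra_simps)+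

lemma coeff_sgn [simp]: "coeff ((- 1) ^ k * f) M = (- 1) ^ k * coeff f M"
  for f :: "'a::comm_superalgebra spoly"
  by (cases "even k") auto

lemma coeff_sg [simp]: "coeff (sg k f) M = sg k (coeff f M)"
  for f :: "'a::comm_superalgebra spoly"
  by (simp add: sg_def)

instantiation spoly :: (comm_superalgebra) comm_superalgebra
begin

definition homog_spoly :: "nat \<Rightarrow> 'a spoly set" where
  "homog_spoly k = {f. \<forall>M. coeff f M \<in> homog (k + mpar M)}"

instance
proof
  fix f g :: "'a spoly" and k i j :: nat and r :: real
  show "homog (k + 2) = (homog k :: 'a spoly set)"
    unfolding homog_spoly_def by (simp add: homog_periodic[of "k + _", simplified])
  show "f \<in> homog k \<Longrightarrow> g \<in> homog k \<Longrightarrow> f + g \<in> homog k"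
    by (simp add: homog_spoly_def homog_add)
  show "f \<in> homog k \<Longrightarrow> r *\<^sub>R f \<in> homog k"
    by (simp add: homog_spoly_def homog_scaleR)
  show "(1 :: 'a spoly) \<in> homog 0"
    by (simp add: homog_spoly_def homog_one)
  show "homog 0 \<inter> homog 1 = {0 :: 'a spoly}"
  proof (intro equalityI subsetI)
    fix f :: "'a spoly" assume f: "f \<in> homog 0 \<inter> homog 1"
    then have "coeff f M = 0" for M
      using homog_disjoint_at[of "coeff f M" "mpar M"] by (auto simp: homog_spoly_def)
    then show "f \<in> {0}" by (auto intro: spoly_eqI)
  qed (simp add: homog_spoly_def)
  show "\<exists>y\<in>homog 0. \<exists>z\<in>homog 1. f = y + z"
  proof -
    define q where "q k x = (SOME y. y \<in> homog k \<and> x - y \<in> homog (Suc k))" for x :: 'a and k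
    have q: "q k x \<in> homog k" "x - q k x \<in> homog (Suc k)" for x :: 'a and k
      using someI_ex[OF homog_split_at[of k x]] by (simp_all add: q_def)
    define p where "p k x = (if x = 0 then 0 else q k x)" for x :: 'a and k
    have p: "p k x \<in> homog k" "x - p k x \<in> homog (Suc k)" "p k 0 = 0" for x k
      using q by (simp_all add: p_def)
    define y where "y = Abs_spoly (\<lambda>M. p (mpar M) (coeff f M))"
    have y: "coeff y M = p (mpar M) (coeff f M)" for M
      unfolding y_def
    proof (subst Abs_spoly_inverse)
      have "finite {M. p (mpar M) (coeff f M) \<noteq> 0}"
        by (rule finite_subset[OF _ finite_support[of f]]) (auto simp: p(3))
      then show "(\<lambda>M. p (mpar M) (coeff f M)) \<in> {f. finite {M. f M \<noteq> 0} \<and> (\<forall>M. \<not> monomial M \<longrightarrow> f M = 0)}"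
        by (simp add: p(3) coeff_not_monomial)
    qed simp
    have "y \<in> homog 0" "f - y \<in> homog 1"
      using p by (simp_all add: homog_spoly_def y)
    then show ?thesis by (intro bexI[of _ y] bexI[of _ "f - y"]) simp_all
  qed
  show "f * g \<in> homog (i + j)" if "f \<in> homog i" "g \<in> homog j"
    unfolding homog_spoly_def
  proof (clarify)
    fix K
    show "coeff (f * g) K \<in> homog (i + j + mpar K)"
    proof (cases "monomial K")
      case True
      have "coeff f M * twist (mpar M) (coeff g N) \<in> homog (i + j + mpar (M + N))" for M N
      proof -
        have "coeff f M * twist (mpar M) (coeff g N) \<in> homog ((i + mpar M) + (j + mpar N))"
          using that by (intro homog_mult twist_in_homog) (auto simp: homog_spoly_def)
        then show ?thesis by (simp add: ac_simps)
      qed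
      then show ?thesis
        unfolding coeff_times[OF True] by (auto intro!: homog_sum homog_sg simp: splits_def)
    qed (simp add: coeff_not_monomial)
  qed
  show "f * g = (- 1) ^ (i * j) * (g * f)" if fg: "f \<in> homog i" "g \<in> homog j"
  proof (rule spoly_eqI)
    fix K :: "pvar multiset" assume K: "monomial K"
    have "sg (crossings M N) (coeff f M * twist (mpar M) (coeff g N)) =
        sg (i * j) (sg (crossings N M) (coeff g N * twist (mpar N) (coeff f M)))"
      if "M + N = K" for M N
    proof -
      have f: "coeff f M \<in> homog (i + mpar M)" and g: "coeff g N \<in> homog (j + mpar N)"
        using fg by (auto simp: homog_spoly_def)
      have *: "crossings M N + crossings N M = mpar M * mpar N"
        using K that crossings_commute by blast
      show ?thesis
        unfolding twist_sg[OF f] twist_sg[OF g] supercommute[OF f g, folded sg_def] sg_simps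
        by (rule sg_cong) (use arg_cong[OF *, of even] in \<open>auto simp: distrib_left distrib_right\<close>)
    qed
    then have "coeff (f * g) K = (\<Sum>(M, N)\<in>splits K.
        sg (i * j) (sg (crossings N M) (coeff g N * twist (mpar N) (coeff f M))))"
      unfolding coeff_times[OF K] by (intro sum.cong) (auto simp: splits_def)
    also have "\<dots> = (\<Sum>(N, M)\<in>splits K.
        sg (i * j) (sg (crossings N M) (coeff g N * twist (mpar N) (coeff f M))))"
      by (rule sum.reindex_bij_witness[of _ prod.swap prod.swap]) (auto simp: splits_def add.commute)
    also have "\<dots> = coeff (sg (i * j) (g * f)) K"
      by (simp add: coeff_times[OF K] sg_sum case_prod_beta)
    finally show "coeff (f * g) K = coeff ((- 1) ^ (i * j) * (g * f)) K"
      by (simp only: sg_def)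
  qed
qed

end

lift_definition Const :: "'a::comm_superalgebra \<Rightarrow> 'a spoly" is "\<lambda>c M. if M = {#} then c else 0"
  by auto

lift_definition Var :: "pvar \<Rightarrow> 'a::comm_superalgebra spoly" is "\<lambda>v M. if M = {#v#} then 1 else 0"
  by auto

lemma finite_support_pd:
  assumes "finite {M. f M \<noteq> 0}" "\<And>N. f (add_mset v N) = 0 \<Longrightarrow> h N = 0"
  shows "finite {N. h N \<noteq> 0}"
proof (rule finite_subset)
  show "{N. h N \<noteq> 0} \<subseteq> (\<lambda>M. M - {#v#}) ` {M. f M \<noteq> 0}"
  proof
    fix N assume "N \<in> {N. h N \<noteq> 0}"
    then have "f (add_mset v N) \<noteq> 0" using assms(2) by blast
    then show "N \<in> (\<lambda>M. M - {#v#}) ` {M. f M \<noteq> 0}"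
      by (intro rev_image_eqI[of "add_mset v N"]) simp_all
  qed
qed (use assms(1) in simp)

text \<open>The left derivative; it is characterised by the lemmas below, ending with the
  Leibniz rule \<open>pd_mult\<close>.\<close>

lift_definition pd :: "pvar \<Rightarrow> 'a::comm_superalgebra spoly \<Rightarrow> 'a spoly" is
  "\<lambda>v f N. (- 1) ^ crossings {#v#} N *
    (of_nat (count N v + 1) * twist (vpar v) (f (add_mset v N)))"
  subgoal for v f
    using finite_support_pd[of f v "\<lambda>N. (- 1) ^ crossings {#v#} N *
      (of_nat (count N v + 1) * twist (vpar v) (f (add_mset v N)))"]
    by (auto simp: monomial_add_mset)
  done

lemma coeff_Const: "coeff (Const c) M = (if M = {#} then c else 0)"
  and coeff_Var: "coeff (Var v) M = (if M = {#v#} then 1 else 0)"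
  and coeff_pd: "coeff (pd v f) N = sg (crossings {#v#} N)
    (of_nat (count N v + 1) * twist (vpar v) (coeff f (add_mset v N)))"
  unfolding sg_def by (transfer, simp)+

lemma Const_homog: "c \<in> homog k \<Longrightarrow> Const c \<in> homog k"
  by (simp add: homog_spoly_def coeff_Const)

lemma Var_homog: "Var v \<in> homog (vpar v)"
  using homog_cong[of "vpar v + vpar v" 0] homog_one
  by (auto simp: homog_spoly_def coeff_Var)

lemma Const_add: "Const (c + d) = Const c + Const d"
  and Const_mult: "Const (c * d) = Const c * Const d"
  and Const_one: "Const 1 = 1"
proof -
  show "Const (c + d) = Const c + Const d" "Const 1 = 1"
    by (rule spoly_eqI; simp add: coeff_Const)+
  show "Const (c * d) = Const c * Const d"
  proof (rule spoly_eqI)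
    fix K :: "pvar multiset" assume "monomial K"
    then show "coeff (Const (c * d)) K = coeff (Const c * Const d) K"
      by (subst coeff_times, simp, subst sum_splits_single[of K "{#}" K])
        (auto simp: coeff_Const splits_def twist_def)
  qed
qed

lemma pd_add: "pd v (f + g) = pd v f + pd v g"
  by (rule spoly_eqI) (simp add: coeff_pd sg_add distrib_left)

lemma pd_Const: "pd v (Const c) = 0"
  by (rule spoly_eqI) (simp add: coeff_pd coeff_Const)

lemma pd_Var: "pd v (Var w) = (if v = w then 1 else 0)"
  by (rule spoly_eqI) (auto simp: coeff_pd coeff_Var)

lemma sum_splits_add_mset:
  assumes "\<And>A B. v \<notin># A \<Longrightarrow> F A B = (0 :: 'b::comm_monoid_add)"
  shows "(\<Sum>(A, B)\<in>splits (add_mset v N). F A B) = (\<Sum>(A, B)\<in>splits N. F (add_mset v A) B)"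
proof -
  have "(\<Sum>(A, B)\<in>splits (add_mset v N). F A B) =
      (\<Sum>(A, B)\<in>{(A, B). (A, B) \<in> splits (add_mset v N) \<and> v \<in># A}. F A B)"
    by (rule sum.mono_neutral_right) (use assms in auto)
  also have "\<dots> = (\<Sum>(A, B)\<in>splits N. F (add_mset v A) B)"
    by (rule sum.reindex_bij_witness[of _ "\<lambda>(A, B). (add_mset v A, B)" "\<lambda>(A, B). (A - {#v#}, B)"])
      (auto simp: splits_def dest!: multi_member_split)
  finally show ?thesis .
qed

lemma sum_splits_commute: "(\<Sum>(A, B)\<in>splits N. F A B) = (\<Sum>(A, B)\<in>splits N. F B A)"
  by (rule sum.reindex_bij_witness[of _ prod.swap prod.swap]) (auto simp: splits_def add.commute)

lemma sum_splits_add_mset':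
  assumes "\<And>A B. v \<notin># B \<Longrightarrow> F A B = (0 :: 'b::comm_monoid_add)"
  shows "(\<Sum>(A, B)\<in>splits (add_mset v N). F A B) = (\<Sum>(A, B)\<in>splits N. F A (add_mset v B))"
  using sum_splits_add_mset[of v "\<lambda>A B. F B A" N] assms
  by (subst (1 2) sum_splits_commute) simp

lemma twist_cong: "even k = even l \<Longrightarrow> twist k = twist l"
  by (auto simp: twist_def)

lemma pd_mult:
  fixes f g :: "'a::comm_superalgebra spoly"
  assumes f: "f \<in> homog j"
  shows "pd v (f * g) = pd v f * g + (- 1) ^ (vpar v * j) * (f * pd v g)"
proof (rule spoly_eqI)
  fix N :: "pvar multiset" assume N: "monomial N"
  define w where "w = vpar v"
  define a b where "a = coeff f" and "b = coeff g"
  define c where "c e A k B = sg e (a A * twist k (b B))" for e A k B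
  define U where "U A B = of_nat (count A v + 1) *
      c (crossings A B + crossings {#v#} A + w * (j + w + mpar A)) (add_mset v A) (mpar A) B" for A B
  define W where "W A B = of_nat (count B v + 1) *
      c (w * j + crossings A B + crossings {#v#} B) A (w + mpar A) (add_mset v B)" for A B
  define Y where "Y A B = c (crossings {#v#} N + crossings A B + w * (j + mpar A)) A (w + mpar A) B" for A B
  have tw: "twist k (a A) = sg (k * (j + mpar A)) (a A)" for k A
    using f by (simp add: twist_sg a_def homog_spoly_def)
  have c_cong: "c e A k B = c e' A k' B" if "even e = even e'" "even k = even k'" for e e' k k' A B
    using that sg_cong[of e e'] twist_cong[of k k', where ?'a = 'a] by (simp add: c_def)
  have of_nat_right: "x * (of_nat n * y) = of_nat n * (x * y)" for n and x y :: 'a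
    by (metis mult.assoc mult_of_nat_commute)
  have cr: "crossings M (add_mset v M') = crossings M {#v#} + crossings M M'"
    "crossings (add_mset v M) M' = crossings {#v#} M' + crossings M M'" for M M'
    by (rule crossings_add_mset)+
  have "coeff (pd v f * g) N = (\<Sum>(A, B)\<in>splits N. U A B)"
    unfolding coeff_times[OF N] coeff_pd
    by (intro sum.cong refl)
      (auto simp: U_def c_def w_def[symmetric] a_def[symmetric] b_def[symmetric] tw
        mult.assoc add_ac simp del: of_nat_add of_nat_Suc)
  moreover have "coeff ((- 1) ^ (w * j) * (f * pd v g)) N = (\<Sum>(A, B)\<in>splits N. W A B)"
    unfolding sg_def[symmetric] coeff_sg coeff_times[OF N] coeff_pd sg_sum
    by (intro sum.cong refl)
      (auto simp: W_def c_def w_def[symmetric] a_def[symmetric] b_def[symmetric]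
        twist_of_nat twist_twist of_nat_right mult.assoc add_ac simp del: of_nat_add of_nat_Suc)
  moreover have "coeff (pd v (f * g)) N = (\<Sum>(A, B)\<in>splits N. U A B) + (\<Sum>(A, B)\<in>splits N. W A B)"
  proof (cases "monomial (add_mset v N)")
    case True
    have "coeff (pd v (f * g)) N = (\<Sum>(A, B)\<in>splits (add_mset v N). of_nat (count N v + 1) * Y A B)"
      unfolding coeff_pd coeff_times[OF True] sg_sum twist_sum sum_distrib_left
      by (intro sum.cong refl)
        (auto simp: Y_def c_def w_def[symmetric] a_def[symmetric] b_def[symmetric] tw
          twist_mult twist_twist mult.assoc add_ac simp del: of_nat_add of_nat_Suc)
    also have "\<dots> = (\<Sum>(A, B)\<in>splits (add_mset v N).
        of_nat (count A v) * Y A B + of_nat (count B v) * Y A B)"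
    proof (intro sum.cong refl, clarify)
      fix A B assume "(A, B) \<in> splits (add_mset v N)"
      then have "count N v + 1 = count A v + count B v"
        by (metis (mono_tags) case_prodD count_add_mset count_union mem_Collect_eq splits_def Suc_eq_plus1)
      then show "of_nat (count N v + 1) * Y A B = of_nat (count A v) * Y A B + of_nat (count B v) * Y A B"
        by (simp only: of_nat_add distrib_right)
    qed
    also have "\<dots> = (\<Sum>(A, B)\<in>splits (add_mset v N). of_nat (count A v) * Y A B) +
        (\<Sum>(A, B)\<in>splits (add_mset v N). of_nat (count B v) * Y A B)"
      by (simp add: case_prod_beta sum.distrib)
    also have "(\<Sum>(A, B)\<in>splits (add_mset v N). of_nat (count A v) * Y A B) =
        (\<Sum>(A, B)\<in>splits N. of_nat (count (add_mset v A) v) * Y (add_mset v A) B)"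
      by (rule sum_splits_add_mset) (simp add: not_in_iff)
    also have "\<dots> = (\<Sum>(A, B)\<in>splits N. U A B)"
    proof (intro sum.cong refl, clarify)
      fix A B assume "(A, B) \<in> splits N"
      then have "N = A + B" by (simp add: splits_def)
      then show "of_nat (count (add_mset v A) v) * Y (add_mset v A) B = U A B"
        unfolding U_def Y_def
        by (intro arg_cong2[of _ _ _ _ "(*)"] c_cong) (auto simp: cr(2)[of A B] w_def[symmetric])
    qed
    also have "(\<Sum>(A, B)\<in>splits (add_mset v N). of_nat (count B v) * Y A B) =
        (\<Sum>(A, B)\<in>splits N. of_nat (count (add_mset v B) v) * Y A (add_mset v B))"
      by (rule sum_splits_add_mset') (simp add: not_in_iff)
    also have "\<dots> = (\<Sum>(A, B)\<in>splits N. W A B)"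
    proof (intro sum.cong refl, clarify)
      fix A B assume "(A, B) \<in> splits N"
      then have AB: "N = A + B" by (simp add: splits_def)
      then have "crossings {#v#} A + crossings A {#v#} = w * mpar A"
        using True unfolding w_def by (intro crossings_commute_single) (auto simp: monomial_add_mset)
      then have "even (crossings {#v#} A + crossings A {#v#}) = even (w * mpar A)" by (rule arg_cong)
      then show "of_nat (count (add_mset v B) v) * Y A (add_mset v B) = W A B"
        unfolding W_def Y_def
        by (intro arg_cong2[of _ _ _ _ "(*)"] c_cong) (auto simp: AB cr(1)[of A B] distrib_left)
    qed
    finally show ?thesis .
  next
    case False
    then have odd: "odd w" and v: "v \<in># N" using N by (auto simp: monomial_add_mset w_def)
    obtain N' where N': "N = add_mset v N'" using v by (metis multi_member_split)
    with N odd have v': "v \<notin># N'" by (simp add: monomial_add_mset w_def)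
    have zero: "a (add_mset v A) = 0" "b (add_mset v A) = 0" if "v \<in># A" for A
      using that odd by (simp_all add: a_def b_def w_def coeff_not_monomial monomial_add_mset)
    have mem: "v \<in># A \<or> v \<in># B" if "(A, B) \<in> splits (add_mset v N')" for A B
    proof -
      have "A + B = add_mset v N'" using that by (simp add: splits_def)
      then have "v \<in># A + B" by simp
      then show ?thesis by simp
    qed
    have SU: "(\<Sum>(A, B)\<in>splits N. U A B) = (\<Sum>(A, B)\<in>splits N'. U A (add_mset v B))"
      unfolding N'
    proof -
      have "(\<Sum>(A, B)\<in>splits (add_mset v N'). U A B) =
          (\<Sum>(A, B)\<in>splits (add_mset v N'). if v \<in># B then U A B else 0)"
        by (intro sum.cong refl) (auto simp: U_def c_def zero dest!: mem)
      also have "\<dots> = (\<Sum>(A, B)\<in>splits N'. U A (add_mset v B))"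
        by (subst sum_splits_add_mset') simp_all
      finally show "(\<Sum>(A, B)\<in>splits (add_mset v N'). U A B) = \<dots>" .
    qed
    have SW: "(\<Sum>(A, B)\<in>splits N. W A B) = (\<Sum>(A, B)\<in>splits N'. W (add_mset v A) B)"
      unfolding N'
    proof -
      have "(\<Sum>(A, B)\<in>splits (add_mset v N'). W A B) =
          (\<Sum>(A, B)\<in>splits (add_mset v N'). if v \<in># A then W A B else 0)"
        by (intro sum.cong refl) (auto simp: W_def c_def zero dest!: mem)
      also have "\<dots> = (\<Sum>(A, B)\<in>splits N'. W (add_mset v A) B)"
        by (subst sum_splits_add_mset) simp_all
      finally show "(\<Sum>(A, B)\<in>splits (add_mset v N'). W A B) = \<dots>" .
    qed
    have UW: "U A (add_mset v B) = - W (add_mset v A) B" if AB: "(A, B) \<in> splits N'" for A B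
    proof -
      have nv: "v \<notin># A" "v \<notin># B" using AB v' by (auto simp: splits_def)
      then have "crossings {#v#} A + crossings A {#v#} = w * mpar A"
        unfolding w_def by (intro crossings_commute_single) simp
      then have ev: "even (crossings {#v#} A + crossings A {#v#}) = even (w * mpar A)" by (rule arg_cong)
      have "- W (add_mset v A) B =
          c (1 + (w * j + crossings (add_mset v A) B + crossings {#v#} B)) (add_mset v A)
            (w + mpar (add_mset v A)) (add_mset v B)"
        using nv by (simp add: W_def not_in_iff c_def sg_def)
      also have "\<dots> = c (crossings A (add_mset v B) + crossings {#v#} A + w * (j + w + mpar A))
          (add_mset v A) (mpar A) (add_mset v B)"
        using ev odd by (intro c_cong) (auto simp: cr(1,2)[of A B] distrib_left w_def[symmetric])
      also have "\<dots> = U A (add_mset v B)"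
        using nv by (simp add: U_def not_in_iff)
      finally show ?thesis ..
    qed
    have "(\<Sum>(A, B)\<in>splits N. U A B) = - (\<Sum>(A, B)\<in>splits N. W A B)"
      unfolding SU SW sum_negf[symmetric] by (intro sum.cong refl) (auto simp: UW)
    moreover have "coeff (pd v (f * g)) N = 0"
      using False by (simp add: coeff_pd coeff_not_monomial)
    ultimately show ?thesis by simp
  qed
  ultimately show "coeff (pd v (f * g)) N = coeff (pd v f * g + (- 1) ^ (vpar v * j) * (f * pd v g)) N"
    by (simp add: w_def)
qed

section \<open>Even bivectors\<close>

text \<open>The components \<open>T\<^sup>a\<^sup>b\<close> are given as \<open>T a b\<close>; only indices in \<open>indices n m\<close> matter.\<close>

definition even_bivector :: "nat \<Rightarrow> nat \<Rightarrow> (index \<Rightarrow> index \<Rightarrow> 'a::comm_superalgebra) \<Rightarrow> bool" where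
  "even_bivector n m T \<longleftrightarrow> (\<forall>a\<in>indices n m. \<forall>b\<in>indices n m.
     T a b \<in> homog (par a + par b) \<and> T a b = - ((- 1) ^ (par a * par b) * T b a))"

definition bivector_fun :: "nat \<Rightarrow> nat \<Rightarrow> (index \<Rightarrow> index \<Rightarrow> 'a::comm_superalgebra) \<Rightarrow> 'a spoly" where
  "bivector_fun n m T =
     (\<Sum>c\<in>indices n m. \<Sum>d\<in>indices n m. Const (T c d) * Var (P 1 c) * Var (P 2 d))"

definition khudaverdian :: "nat \<Rightarrow> nat \<Rightarrow> 'a::comm_superalgebra spoly \<Rightarrow> bool" where
  "khudaverdian n m F \<longleftrightarrow>
     (\<forall>i\<in>{1, 2}. \<forall>j\<in>{1, 2}. \<forall>a\<in>indices n m. \<forall>b\<in>indices n m.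
        pd (P i a) F * pd (P j b) F - pd (P j a) F * pd (P i b) F
          - F * pd (P i a) (pd (P j b) F) = 0)"

definition super_pluecker :: "nat \<Rightarrow> nat \<Rightarrow> (index \<Rightarrow> index \<Rightarrow> 'a::comm_superalgebra) \<Rightarrow> bool" where
  "super_pluecker n m T \<longleftrightarrow>
     (\<forall>a\<in>indices n m. \<forall>b\<in>indices n m. \<forall>c\<in>indices n m. \<forall>d\<in>indices n m.
        T a b * T c d * (- 1) ^ (par b * (par a + par c + par d)) =
        T a c * T b d * (- 1) ^ (par c * (par a + par d)) +
        T a d * T c b * (- 1) ^ (par b * par c + par a * par d))"

end

theory Submission
  imports Defs
begin

text \<open>For \<open>i = j\<close> the Khudaverdian relation holds because \<open>T(p)\<close> is linear in each covector, and
  since the mixed derivatives of an even bivector change sign when \<open>1\<close> and \<open>2\<close> are exchanged,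
  the relation for \<open>(i, j) = (2, 1)\<close> is the negative of the one for \<open>(1, 2)\<close>. The left-hand side
  of the latter is again bilinear in \<open>p\<^sup>1\<close> and \<open>p\<^sup>2\<close>; up to a sign, its coefficient at
  \<open>p\<^sup>1\<^sub>c p\<^sup>2\<^sub>d\<close> is the difference of the two sides of the super Pluecker relation.\<close>

section \<open>Signs and constant polynomials\<close>

lemma Const_sg: "Const (sg k x) = sg k (Const x)"
  by (rule spoly_eqI) (simp add: coeff_Const)

lemma Const_eq_0_iff [simp]: "Const x = 0 \<longleftrightarrow> x = 0"
proof
  assume "Const x = 0"
  then have "coeff (Const x) {#} = 0" by simp
  then show "x = 0" by (simp add: coeff_Const)
qed (auto intro: spoly_eqI simp: coeff_Const)

lemma Const_0 [simp]: "Const 0 = 0"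
  by simp

lemma Const_diff: "Const (x - y) = Const x - Const y"
  by (rule spoly_eqI) (simp add: coeff_Const)

lemma Const_minus: "Const (- x) = - Const x"
  by (rule spoly_eqI) (simp add: coeff_Const)

text \<open>Brings the signs of \<open>super_pluecker\<close>, which stand as right factors, into
  the form that \<open>sg_simps\<close> collects.\<close>

lemma mult_minus_one_power: "x * (- 1) ^ k = sg k (x :: 'a::ring_1)"
  by (cases "even k") (simp_all add: sg_def)

lemma sg_minus: "sg k (- x) = - sg k x"
  by (simp add: sg_def)

lemma sg_eq_0_iff [simp]: "sg k x = 0 \<longleftrightarrow> x = 0"
  by (cases "even k") (simp_all add: sg_def)

lemma sg_even [simp]: "even k \<Longrightarrow> sg k x = x"
  and sg_odd [simp]: "odd k \<Longrightarrow> sg k x = - x"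
  by (simp_all add: sg_def)

text \<open>A parity occurring twice does not affect the sign; this happens when a coefficient with
  index \<open>c\<close> and the variable \<open>P i c\<close> are passed together.\<close>

lemma sg_twice_cancel: "sg (p * (k + q + r + q)) x = sg (p * (k + r)) x"
  by (rule sg_cong) (unfold even_add even_mult_iff, blast)

section \<open>Left derivatives of short products\<close>

lemma pd_0 [simp]: "pd v 0 = 0"
  using pd_add[of v 0 0] by simp

lemma pd_sum: "pd v (sum f I) = (\<Sum>i\<in>I. pd v (f i))"
  by (induction I rule: infinite_finite_induct) (simp_all add: pd_add)

lemma pd_Const_mult:
  assumes "x \<in> homog k"
  shows "pd v (Const x * f) = sg (vpar v * k) (Const x * pd v f)"
  using pd_mult[OF Const_homog[OF assms], of v f] by (simp add: pd_Const sg_def)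

lemma pd_Const_Var:
  assumes "x \<in> homog k"
  shows "pd v (Const x * Var w) = (if v = w then Const (sg (vpar v * k) x) else 0)"
  using assms by (simp add: pd_Const_mult pd_Var Const_sg)

text \<open>To reach \<open>Var u\<close> the derivative passes only the constant, to reach
  \<open>Var w\<close> also \<open>Var u\<close>; both terms are present if
  \<open>u = w\<close>.\<close>

lemma pd_Const_Var_Var:
  assumes "x \<in> homog k"
  shows "pd v (Const x * Var u * Var w) =
    (if v = u then Const (sg (vpar v * k) x) * Var w else 0) +
    (if v = w then Const (sg (vpar v * (k + vpar u)) x) * Var u else 0)"
  using pd_mult[OF homog_mult[OF Const_homog[OF assms] Var_homog], of v u "Var w"] assms
  by (auto simp: pd_Const_Var pd_Var Const_sg sg_def[symmetric])

section \<open>Linear and bilinear functions of the covectors\<close>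

lemma finite_indices [simp]: "finite (indices n m)"
  by (simp add: indices_def)

text \<open>The shape of the first derivatives of a bilinear function, with coefficients on the left
  as in \<open>bivector_fun\<close>.\<close>

definition covector_fun :: "nat \<Rightarrow> nat \<Rightarrow> nat \<Rightarrow> (index \<Rightarrow> 'a::comm_superalgebra) \<Rightarrow> 'a spoly" where
  "covector_fun n m i x = (\<Sum>a\<in>indices n m. Const (x a) * Var (P i a))"

text \<open>Here \<open>k\<close> is the parity of the whole linear function. It has to be
  arbitrary, since differentiating the even \<open>T(p)\<close> by a component with index
  \<open>a\<close> leaves parity \<open>par a\<close>.\<close>

lemma pd_covector_fun:
  assumes "\<And>d. d \<in> indices n m \<Longrightarrow> x d \<in> homog (k + par d)" "a \<in> indices n m"
  shows "pd (P j a) (covector_fun n m i x) =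
    (if j = i then Const (sg (par a * (k + par a)) (x a)) else 0)"
proof -
  have "pd (P j a) (covector_fun n m i x) =
      (\<Sum>d\<in>indices n m. if a = d then
        (if j = i then Const (sg (par a * (k + par a)) (x a)) else 0) else 0)"
    unfolding covector_fun_def pd_sum
    by (intro sum.cong refl) (auto simp: pd_Const_Var[OF assms(1)])
  then show ?thesis using assms(2) by simp
qed

lemma pd_1_bivector_fun:
  assumes "\<And>c d. c \<in> indices n m \<Longrightarrow> d \<in> indices n m \<Longrightarrow> K c d \<in> homog (k + par c + par d)"
    and "a \<in> indices n m"
  shows "pd (P 1 a) (bivector_fun n m K) =
    covector_fun n m 2 (\<lambda>d. sg (par a * (k + par a + par d)) (K a d))"
proof -
  have "pd (P 1 a) (bivector_fun n m K) = (\<Sum>c\<in>indices n m. if a = c then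
      covector_fun n m 2 (\<lambda>d. sg (par a * (k + par a + par d)) (K a d)) else 0)"
    unfolding bivector_fun_def covector_fun_def pd_sum
    by (intro sum.cong refl) (auto simp: pd_Const_Var_Var[OF assms(1)] intro!: sum.cong)
  then show ?thesis using assms(2) by simp
qed

text \<open>The derivative passes both \<open>K c b\<close> and \<open>Var (P 1 c)\<close>, so
  \<open>par c\<close> cancels from the sign.\<close>

lemma pd_2_bivector_fun:
  assumes "\<And>c d. c \<in> indices n m \<Longrightarrow> d \<in> indices n m \<Longrightarrow> K c d \<in> homog (k + par c + par d)"
    and "b \<in> indices n m"
  shows "pd (P 2 b) (bivector_fun n m K) =
    covector_fun n m 1 (\<lambda>c. sg (par b * (k + par b)) (K c b))"
proof -
  have "pd (P 2 b) (bivector_fun n m K) = (\<Sum>c\<in>indices n m. \<Sum>d\<in>indices n m. if b = d then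
      Const (sg (par b * (k + par b)) (K c b)) * Var (P 1 c) else 0)"
    unfolding bivector_fun_def pd_sum
  proof (intro sum.cong refl)
    fix c d assume cd: "c \<in> indices n m" "d \<in> indices n m"
    show "pd (P 2 b) (Const (K c d) * Var (P 1 c) * Var (P 2 d)) =
        (if b = d then Const (sg (par b * (k + par b)) (K c b)) * Var (P 1 c) else 0)"
      by (simp add: pd_Const_Var_Var[OF assms(1)[OF cd]] sg_twice_cancel)
  qed
  then show ?thesis using assms(2) by (simp add: covector_fun_def)
qed

lemma covector_fun_1_mult_2:
  assumes "\<And>d. d \<in> indices n m \<Longrightarrow> y d \<in> homog (l + par d)"
  shows "covector_fun n m 1 x * covector_fun n m 2 y =
    bivector_fun n m (\<lambda>c d. sg (par c * (l + par d)) (x c * y d))"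
  unfolding covector_fun_def bivector_fun_def sum_product
proof (intro sum.cong refl)
  fix c d assume "d \<in> indices n m"
  from supercommute[OF Var_homog Const_homog[OF assms[OF this]], of "P 1 c"]
  have *: "Var (P 1 c) * Const (y d) = sg (par c * (l + par d)) (Const (y d) * Var (P 1 c))"
    by (simp add: sg_def)
  have "Const (x c) * Var (P 1 c) * (Const (y d) * Var (P 2 d)) =
      Const (x c) * (Var (P 1 c) * Const (y d)) * Var (P 2 d)"
    by (simp add: mult.assoc)
  then show "Const (x c) * Var (P 1 c) * (Const (y d) * Var (P 2 d)) =
      Const (sg (par c * (l + par d)) (x c * y d)) * Var (P 1 c) * Var (P 2 d)"
    unfolding * by (simp add: Const_sg Const_mult mult.assoc)
qed

text \<open>\<open>Var (P 2 d)\<close> moves to the right past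
  \<open>Const (y c) * Var (P 1 c)\<close>, whose parity is \<open>l\<close> modulo 2 for every
  \<open>c\<close>.\<close>

lemma covector_fun_2_mult_1:
  assumes "\<And>c. c \<in> indices n m \<Longrightarrow> y c \<in> homog (l + par c)"
  shows "covector_fun n m 2 x * covector_fun n m 1 y =
    bivector_fun n m (\<lambda>c d. sg (par d * l) (x d * y c))"
  unfolding covector_fun_def bivector_fun_def sum_product
\<comment> \<open>The product sums over the index of the second covector first,
  \<open>bivector_fun\<close> over that of the first.\<close>
proof (subst sum.swap, intro sum.cong refl)
  fix c d assume c: "c \<in> indices n m"
  from supercommute[OF Var_homog homog_mult[OF Const_homog[OF assms[OF c]] Var_homog], of "P 2 d" "P 1 c"]
  have "Var (P 2 d) * (Const (y c) * Var (P 1 c)) =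
      sg (par d * (l + par c + par c)) (Const (y c) * Var (P 1 c) * Var (P 2 d))"
    by (simp add: sg_def)
  also have "\<dots> = sg (par d * l) (Const (y c) * Var (P 1 c) * Var (P 2 d))"
    using sg_twice_cancel[of "par d" l "par c" 0] by simp
  finally show "Const (x d) * Var (P 2 d) * (Const (y c) * Var (P 1 c)) =
      Const (sg (par d * l) (x d * y c)) * Var (P 1 c) * Var (P 2 d)"
    by (simp add: Const_sg Const_mult mult.assoc)
qed

lemma bivector_fun_mult_Const:
  assumes "t \<in> homog l"
  shows "bivector_fun n m K * Const t =
    bivector_fun n m (\<lambda>c d. sg ((par c + par d) * l) (K c d * t))"
  unfolding bivector_fun_def sum_distrib_right
proof (intro sum.cong refl)
  fix c d
  from supercommute[OF homog_mult[OF Var_homog Var_homog] Const_homog[OF assms], of "P 1 c" "P 2 d"]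
  have "Var (P 1 c) * Var (P 2 d) * Const t =
      sg ((par c + par d) * l) (Const t * (Var (P 1 c) * Var (P 2 d)))"
    by (simp add: sg_def)
  then show "Const (K c d) * Var (P 1 c) * Var (P 2 d) * Const t =
      Const (sg ((par c + par d) * l) (K c d * t)) * Var (P 1 c) * Var (P 2 d)"
    by (simp add: Const_sg Const_mult mult.assoc)
qed

lemma bivector_fun_diff:
  "bivector_fun n m K - bivector_fun n m L = bivector_fun n m (\<lambda>c d. K c d - L c d)"
  by (simp add: bivector_fun_def Const_diff left_diff_distrib sum_subtractf)

text \<open>Differentiating by \<open>P 1 c\<close> and then by \<open>P 2 d\<close> isolates
  \<open>K c d\<close> up to a sign; homogeneity is what makes that sign available.\<close>

lemma bivector_fun_eq_0_iff:
  assumes "\<And>c d. c \<in> indices n m \<Longrightarrow> d \<in> indices n m \<Longrightarrow> K c d \<in> homog (k + par c + par d)"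
  shows "bivector_fun n m K = 0 \<longleftrightarrow> (\<forall>c\<in>indices n m. \<forall>d\<in>indices n m. K c d = 0)"
proof (intro iffI ballI)
  fix c d assume *: "bivector_fun n m K = 0" "c \<in> indices n m" "d \<in> indices n m"
  have "sg (par c * (k + par c + par e)) (K c e) \<in> homog (k + par c + par e)"
    if "e \<in> indices n m" for e
    using assms[OF *(2) that] by (rule homog_sg)
  from pd_covector_fun[OF this *(3), where j = 2 and i = 2] *
  show "K c d = 0"
    using pd_1_bivector_fun[where K = K and k = k and a = c, OF assms *(2)]
    by simp
qed (simp add: bivector_fun_def)

section \<open>The Khudaverdian expression of an even bivector\<close>

lemma par_cases: "par a = 0 \<or> par a = 1"
  by (cases a) simp_all

definition pluecker_defect ::
    "(index \<Rightarrow> index \<Rightarrow> 'a::comm_superalgebra) \<Rightarrow> index \<Rightarrow> index \<Rightarrow> index \<Rightarrow> index \<Rightarrow> 'a" where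
  "pluecker_defect T a b c d =
     T a b * T c d * (- 1) ^ (par b * (par a + par c + par d)) -
     T a c * T b d * (- 1) ^ (par c * (par a + par d)) -
     T a d * T c b * (- 1) ^ (par b * par c + par a * par d)"

context
  fixes n m :: nat and T :: "index \<Rightarrow> index \<Rightarrow> 'a::comm_superalgebra"
  assumes T: "even_bivector n m T"
begin

lemma bivector_homog:
  "a \<in> indices n m \<Longrightarrow> b \<in> indices n m \<Longrightarrow> T a b \<in> homog (par a + par b)"
  using T unfolding even_bivector_def by blast

lemma bivector_skew:
  "a \<in> indices n m \<Longrightarrow> b \<in> indices n m \<Longrightarrow> T a b = - sg (par a * par b) (T b a)"
  using T unfolding even_bivector_def sg_def by blast

lemma pd_bivector:
  assumes "a \<in> indices n m"
  shows "pd (P 1 a) (bivector_fun n m T) =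
      covector_fun n m 2 (\<lambda>d. sg (par a * (par a + par d)) (T a d))"
    and "pd (P 2 a) (bivector_fun n m T) = covector_fun n m 1 (\<lambda>c. sg (par a * par a) (T c a))"
  using pd_1_bivector_fun[where K = T and k = 0, unfolded add_0, OF bivector_homog assms]
    pd_2_bivector_fun[where K = T and k = 0, unfolded add_0, OF bivector_homog assms]
  by simp_all

lemma pd_pd_bivector:
  assumes "a \<in> indices n m" "b \<in> indices n m"
  shows "pd (P 1 a) (pd (P 1 b) (bivector_fun n m T)) = 0" (is ?A1)
    and "pd (P 2 a) (pd (P 2 b) (bivector_fun n m T)) = 0" (is ?A2)
    and "pd (P 1 a) (pd (P 2 b) (bivector_fun n m T)) = 
      Const (sg (par a * (par b + par a) + par b * par b) (T a b))" (is ?A3)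
    and "pd (P 2 a) (pd (P 1 b) (bivector_fun n m T)) = 
      Const (sg (par a * (par b + par a) + par b * (par b + par a)) (T b a))" (is ?A4)
proof -
  have *: "sg (par b * (par b + par d)) (T b d) \<in> homog (par b + par d)"
      "sg (par b * par b) (T d b) \<in> homog (par b + par d)" if "d \<in> indices n m" for d
    using bivector_homog[OF assms(2) that] bivector_homog[OF that assms(2)]
    by (simp_all add: homog_sg add.commute)
  note 1 = pd_covector_fun[OF *(1) assms(1), simplified] and 2 = pd_covector_fun[OF *(2) assms(1), simplified]
  show ?A1 ?A2 ?A3 ?A4
    unfolding pd_bivector[OF assms(2)] by (simp_all only: 1 2) simp_all
qed

text \<open>Skewness turns \<open>T b a\<close> into \<open>T a b\<close>; the remaining sign is
  that of \<open>par a * par b + par a + par b\<close> in both derivatives, apart from the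
  minus.\<close>

lemma pd_pd_bivector_skew:
  assumes "a \<in> indices n m" "b \<in> indices n m"
  shows "pd (P 2 a) (pd (P 1 b) (bivector_fun n m T)) =
    - pd (P 1 a) (pd (P 2 b) (bivector_fun n m T))"
  unfolding pd_pd_bivector[OF assms] bivector_skew[OF assms(2,1)]
  using par_cases[of a] par_cases[of b] by (auto simp: Const_sg Const_minus sg_minus)

text \<open>Provides the homogeneity needed to compare coefficients by
  \<open>bivector_fun_eq_0_iff\<close>.\<close>

lemma pluecker_defect_homog:
  assumes "a \<in> indices n m" "b \<in> indices n m" "c \<in> indices n m" "d \<in> indices n m"
  shows "pluecker_defect T a b c d \<in> homog (par a + par b + par c + par d)"
proof -
  have "T a b * T c d \<in> homog (par a + par b + par c + par d)"
      "T a c * T b d \<in> homog (par a + par b + par c + par d)"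
      "T a d * T c b \<in> homog (par a + par b + par c + par d)"
    using homog_mult[OF bivector_homog bivector_homog, of a b c d]
      homog_mult[OF bivector_homog bivector_homog, of a c b d]
      homog_mult[OF bivector_homog bivector_homog, of a d c b] assms
    by (simp_all add: ac_simps)
  then show ?thesis
    unfolding pluecker_defect_def mult_minus_one_power by (intro homog_diff homog_sg)
qed

text \<open>The three terms contribute the products \<open>T a d * T c b\<close>,
  \<open>T c a * T b d\<close> and \<open>T c d * T a b\<close>. The overall sign can be read off
  from the last: reordered and with its minus it has exponent
  \<open>1 + par a + par b + par a * par b\<close>, against
  \<open>par b * (par a + par c + par d)\<close> in the defect.\<close>

lemma khudaverdian_12:
  assumes a: "a \<in> indices n m" and b: "b \<in> indices n m"
  defines "F \<equiv> bivector_fun n m T"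
  shows "pd (P 1 a) F * pd (P 2 b) F - pd (P 2 a) F * pd (P 1 b) F - F * pd (P 1 a) (pd (P 2 b) F) =
    bivector_fun n m (\<lambda>c d. sg (1 + par a + par b + par b * (par c + par d)) (pluecker_defect T a b c d))"
proof -
  have A: "pd (P 1 a) F * pd (P 2 b) F = bivector_fun n m (\<lambda>c d. sg (par d * par b)
      (sg (par a * (par a + par d)) (T a d) * sg (par b * par b) (T c b)))"
    unfolding F_def pd_bivector[OF a] pd_bivector[OF b]
    by (rule covector_fun_2_mult_1)
      (use b in \<open>auto intro!: homog_sg simp: bivector_homog add.commute[of "par b"]\<close>)
  have B: "pd (P 2 a) F * pd (P 1 b) F = bivector_fun n m (\<lambda>c d. sg (par c * (par b + par d))
      (sg (par a * par a) (T c a) * sg (par b * (par b + par d)) (T b d)))"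
    unfolding F_def pd_bivector[OF a] pd_bivector[OF b]
    by (rule covector_fun_1_mult_2) (use b in \<open>auto intro!: homog_sg simp: bivector_homog\<close>)
  have C: "F * pd (P 1 a) (pd (P 2 b) F) = bivector_fun n m (\<lambda>c d. sg ((par c + par d) * (par a + par b))
      (T c d * sg (par a * (par b + par a) + par b * par b) (T a b)))"
    unfolding F_def pd_pd_bivector[OF a b]
    by (rule bivector_fun_mult_Const) (use a b in \<open>auto intro!: homog_sg simp: bivector_homog\<close>)
  \<comment> \<open>Coefficients need to agree only on \<open>indices n m\<close>, where skewness
    and homogeneity of \<open>T\<close> are available.\<close>
  have "bivector_fun n m K = bivector_fun n m L"
    if "\<And>c d. c \<in> indices n m \<Longrightarrow> d \<in> indices n m \<Longrightarrow> K c d = L c d" for K L :: "index \<Rightarrow> index \<Rightarrow> 'a"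
    unfolding bivector_fun_def by (intro sum.cong refl) (simp add: that)
  then show ?thesis
    unfolding A B C bivector_fun_diff
  proof this
    fix c d assume cd: "c \<in> indices n m" "d \<in> indices n m"
    have comm: "T c d * T a b = sg ((par c + par d) * (par a + par b)) (T a b * T c d)"
      using supercommute[OF bivector_homog[OF cd] bivector_homog[OF a b]] by (simp add: sg_def)
    show "sg (par d * par b) (sg (par a * (par a + par d)) (T a d) * sg (par b * par b) (T c b)) -
        sg (par c * (par b + par d)) (sg (par a * par a) (T c a) * sg (par b * (par b + par d)) (T b d)) -
        sg ((par c + par d) * (par a + par b)) (T c d * sg (par a * (par b + par a) + par b * par b) (T a b)) =
        sg (1 + par a + par b + par b * (par c + par d)) (pluecker_defect T a b c d)"
      unfolding pluecker_defect_def mult_minus_one_power bivector_skew[OF cd(1) a] sg_simps comm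
      \<comment> \<open>The exponents agree only modulo 2, so all sixteen combinations of parities
        are checked.\<close>
      using par_cases[of a] par_cases[of b] par_cases[of c] par_cases[of d]
      by (elim disjE; simp add: sg_minus algebra_simps)
  qed
qed

lemma khudaverdian_12_iff:
  assumes a: "a \<in> indices n m" and b: "b \<in> indices n m"
  defines "F \<equiv> bivector_fun n m T"
  shows "pd (P 1 a) F * pd (P 2 b) F - pd (P 2 a) F * pd (P 1 b) F - F * pd (P 1 a) (pd (P 2 b) F) = 0 \<longleftrightarrow>
    (\<forall>c\<in>indices n m. \<forall>d\<in>indices n m. pluecker_defect T a b c d = 0)"
  unfolding F_def khudaverdian_12[OF a b]
  by (subst bivector_fun_eq_0_iff[where k = "par a + par b"])
    (simp_all add: pluecker_defect_homog a b homog_sg del: sg_simps)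

end

theorem theorem11:
  fixes n m :: nat and T :: "index \<Rightarrow> index \<Rightarrow> 'a::comm_superalgebra"
  assumes "even_bivector n m T"
  shows "khudaverdian n m (bivector_fun n m T) \<longleftrightarrow> super_pluecker n m T"
proof -
  define F where "F = bivector_fun n m T"
  have "khudaverdian n m F \<longleftrightarrow> (\<forall>a\<in>indices n m. \<forall>b\<in>indices n m.
      pd (P 1 a) F * pd (P 2 b) F - pd (P 2 a) F * pd (P 1 b) F - F * pd (P 1 a) (pd (P 2 b) F) = 0)"
    (is "_ \<longleftrightarrow> (\<forall>a\<in>_. \<forall>b\<in>_. ?R a b = 0)")
  proof -
    define S where "S i j a b = pd (P i a) F * pd (P j b) F - pd (P j a) F * pd (P i b) F
        - F * pd (P i a) (pd (P j b) F)" for i j a b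
    \<comment> \<open>For \<open>i = j\<close> the two products coincide, leaving only a vanishing
      second derivative; for \<open>(2, 1)\<close> they trade places and the mixed derivative
      changes sign.\<close>
    have "S 1 1 a b = 0" "S 2 2 a b = 0" "S 2 1 a b = - S 1 2 a b"
      if "a \<in> indices n m" "b \<in> indices n m" for a b
      using pd_pd_bivector(1,2)[OF assms that] pd_pd_bivector_skew[OF assms that]
      by (simp_all add: S_def F_def)
    then show ?thesis
      unfolding khudaverdian_def S_def[symmetric] by (auto simp del: One_nat_def)
  qed
  also have "\<dots> \<longleftrightarrow> super_pluecker n m T"
    using khudaverdian_12_iff[OF assms]
    \<comment> \<open>\<open>diff_diff_eq\<close> merges the two subtractions of the defect into the
      right-hand side of the Pluecker relation.\<close>
    by (simp add: F_def super_pluecker_def pluecker_defect_def diff_diff_eq del: One_nat_def)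
  finally show ?thesis unfolding F_def .
qed

end
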